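(* Let $p$ be a prime number, let $k\ge 0$ be an integer, and let $d=p^k$ or $d=2p^k$. Let $K$ be any field of characteristic $0$ and let $P\in K[X]$ be a monic polynomial of degree $d$. Then $\gcd(P,P_i)$ is nontrivial (i.e. of positive degree) for every $i=1,\ldots,d-1$ if and only if $P=(X-\alpha)^d$ for some $\alpha\in K$. (That is, the Casas-Alvero Conjecture holds in characteristic $0$ for polynomials of degree $d$.)
   Context: For $P=a_0X^d+a_1X^{d-1}+\cdots+a_d\in K[X]$, the $i$th Hasse derivative is $P_i=\sum_{j=i}^{d}\binom{j}{i}a_{d-j}X^{j-i}$; in characteristic $0$ this equals $P^{(i)}/i!$, where $P^{(i)}$ is the $i$th usual derivative. *)

theory Defs
  imports "HOL-Computational_Algebra.Computational_Algebra"
begin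

text \<open>
  With \<^term>\<open>d = degree P\<close>, \<^term>\<open>coeff P j\<close> is the coefficient of \<open>X^j\<close>, that is,
  \<open>a_(d-j)\<close> when the coefficients are listed from the leading one downwards.
\<close>

definition hasse_deriv :: "nat \<Rightarrow> 'a::comm_semiring_1 poly \<Rightarrow> 'a poly" where
  "hasse_deriv i P = (\<Sum>j=i..degree P. monom (of_nat (j choose i) * coeff P j) (j - i))"

lemma coeff_hasse_deriv:
  "coeff (hasse_deriv i P) n = of_nat ((n + i) choose i) * coeff P (n + i)"
proof -
  have "coeff (hasse_deriv i P) n =
      (\<Sum>j=i..degree P. if j = n + i then of_nat (j choose i) * coeff P j else 0)"
    unfolding hasse_deriv_def coeff_sum coeff_monom by (intro sum.cong) auto
  also have "\<dots> = of_nat ((n + i) choose i) * coeff P (n + i)"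
    by (auto simp: coeff_eq_0)
  finally show ?thesis .
qed

lemma hasse_deriv_conv_pderiv:
  fixes P :: "'a::field_char_0 poly"
  shows "hasse_deriv i P = smult (inverse (fact i)) ((pderiv ^^ i) P)"
proof (rule poly_eqI)
  fix n
  have "(fact (n + i) :: 'a) = fact n * pochhammer (of_nat (Suc n)) i"
    by (simp only: pochhammer_fact pochhammer_product'[of 1 n i] of_nat_Suc)
  moreover have "(of_nat ((n + i) choose i) :: 'a) = fact (n + i) / (fact i * fact n)"
    by (subst binomial_fact) auto
  ultimately have "(of_nat ((n + i) choose i) :: 'a) =
      inverse (fact i) * pochhammer (of_nat (Suc n)) i"
    by (simp only: divide_inverse) (simp del: of_nat_Suc)
  then show "coeff (hasse_deriv i P) n = coeff (smult (inverse (fact i)) ((pderiv ^^ i) P)) n"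
    by (simp only: coeff_hasse_deriv coeff_higher_pderiv coeff_smult mult.assoc)
qed

text \<open>
  The overloaded \<^const>\<open>gcd\<close> exists on polynomials only over coefficient types of class
  \<^class>\<open>field_gcd\<close>. The following monic gcd is available over every field; on
  \<^class>\<open>field_gcd\<close> types it coincides with \<^const>\<open>gcd\<close>.
\<close>

definition is_poly_gcd :: "'a::field poly \<Rightarrow> 'a poly \<Rightarrow> 'a poly \<Rightarrow> bool" where
  "is_poly_gcd p q g \<longleftrightarrow>
     g dvd p \<and> g dvd q \<and> (\<forall>h. h dvd p \<longrightarrow> h dvd q \<longrightarrow> h dvd g) \<and> (g = 0 \<or> lead_coeff g = 1)"

definition poly_gcd :: "'a::field poly \<Rightarrow> 'a poly \<Rightarrow> 'a poly" where
  "poly_gcd p q = (THE g. is_poly_gcd p q g)"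

lemma is_poly_gcd_unique:
  assumes "is_poly_gcd p q g" "is_poly_gcd p q h"
  shows "g = h"
proof -
  have dvd: "g dvd h" "h dvd g" using assms unfolding is_poly_gcd_def by blast+
  show ?thesis
  proof (cases "g = 0")
    case True
    then show ?thesis using dvd(1) by simp
  next
    case False
    then have "h \<noteq> 0" using dvd(2) by (metis dvd_0_left)
    from dvd(1) obtain c where c: "h = g * c" by (elim dvdE)
    have "degree h \<le> degree g" using dvd(2) False by (rule dvd_imp_degree_le)
    moreover have "c \<noteq> 0" using \<open>h \<noteq> 0\<close> c by auto
    ultimately have "degree c = 0" using c False by (simp add: degree_mult_eq)
    moreover have "lead_coeff c = 1"
      using assms False \<open>h \<noteq> 0\<close> c unfolding is_poly_gcd_def by (simp add: lead_coeff_mult)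
    ultimately have "c = 1" by (metis degree_eq_zeroE lead_coeff_pCons(2) one_pCons)
    then show ?thesis using c by simp
  qed
qed

lemma is_poly_gcd_exists: "\<exists>g. is_poly_gcd p q g"
proof (induction "euclidean_size q" arbitrary: p q rule: less_induct)
  case less
  show ?case
  proof (cases "q = 0")
    case True
    have "is_poly_gcd p q (smult (inverse (lead_coeff p)) p)"
      by (cases "p = 0") (auto simp: True is_poly_gcd_def smult_dvd_iff dvd_smult)
    then show ?thesis ..
  next
    case False
    then have "euclidean_size (p mod q) < euclidean_size q" by (rule mod_size_less)
    from less[OF this, of q] obtain g where g: "is_poly_gcd q (p mod q) g" by blast
    have "is_poly_gcd p q g"
      using g by (auto simp: is_poly_gcd_def dvd_mod_iff dvd_mod)
    then show ?thesis ..
  qed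
qed

lemma is_poly_gcd_poly_gcd: "is_poly_gcd p q (poly_gcd p q)"
proof -
  have "\<exists>!g. is_poly_gcd p q g" using is_poly_gcd_exists is_poly_gcd_unique by (intro ex_ex1I)
  then show ?thesis unfolding poly_gcd_def by (rule theI')
qed

lemma poly_gcd_eq_gcd:
  fixes p q :: "'a::field_gcd poly"
  shows "poly_gcd p q = gcd p q"
proof -
  have "lead_coeff (gcd p q) = 1" if "gcd p q \<noteq> 0"
  proof -
    have "unit_factor (gcd p q) = 1" using unit_factor_normalize[of "gcd p q"] that by simp
    then show ?thesis using that
      by (simp add: unit_factor_poly_def monom_0 one_pCons is_unit_unit_factor dvd_field_iff)
  qed
  then have "is_poly_gcd p q (gcd p q)" by (auto simp: is_poly_gcd_def)
  then show ?thesis using is_poly_gcd_unique is_poly_gcd_poly_gcd by blast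
qed

end

theory Submission
  imports "HOL-Algebra.Algebraic_Closure_Type" Defs
begin

text \<open>
  Work over the algebraic closure, in a valuation ring \<open>A\<close> whose maximal ideal \<open>M\<close> contains
  \<open>p\<close>. Translate \<open>P\<close> so that \<open>0\<close> is a common root of \<open>P\<close> and \<open>P_q\<close>, where \<open>q = p^k\<close>. If
  there is another root, rescale so that all roots lie in \<open>A\<close> and \<open>1\<close> is one of them. As \<open>p\<close>
  divides all binomial coefficients of \<open>d\<close> over \<open>i\<close> with \<open>0 < i < d\<close> and \<open>i \<noteq> q\<close>, evaluating
  \<open>P_i\<close> at a common root with \<open>P\<close> puts the coefficient of \<open>X^i\<close> into \<open>M\<close>, by downward induction
  on \<open>i\<close>; the coefficients at \<open>0\<close> and \<open>q\<close> vanish by the choice of the translation. So \<open>P\<close> is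
  \<open>X^d\<close> modulo \<open>M\<close>, contradicting the root \<open>1\<close>.
\<close>

section \<open>Valuation subrings of a field\<close>

locale unital_subring =
  fixes A :: "'a::field set"
  assumes one_mem: "1 \<in> A"
    and diff_mem: "x \<in> A \<Longrightarrow> y \<in> A \<Longrightarrow> x - y \<in> A"
    and mult_mem: "x \<in> A \<Longrightarrow> y \<in> A \<Longrightarrow> x * y \<in> A"
begin

lemma zero_mem: "0 \<in> A"
  using diff_mem[OF one_mem one_mem] by simp

lemma uminus_mem: "x \<in> A \<Longrightarrow> - x \<in> A"
  using diff_mem[OF zero_mem] by fastforce

lemma add_mem: "x \<in> A \<Longrightarrow> y \<in> A \<Longrightarrow> x + y \<in> A"
  using diff_mem[OF _ uminus_mem] by fastforce

lemma sum_mem: "(\<And>i. i \<in> I \<Longrightarrow> f i \<in> A) \<Longrightarrow> sum f I \<in> A"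
  by (induction I rule: infinite_finite_induct) (auto intro: zero_mem add_mem)

lemma power_mem: "x \<in> A \<Longrightarrow> x ^ n \<in> A"
  by (induction n) (auto intro: one_mem mult_mem)

lemma of_nat_mem: "of_nat n \<in> A"
  by (induction n) (auto intro: zero_mem one_mem add_mem)

lemma poly_mem: "range (coeff f) \<subseteq> A \<Longrightarrow> x \<in> A \<Longrightarrow> poly f x \<in> A"
  unfolding poly_altdef by (intro sum_mem mult_mem power_mem) auto

text \<open>This is the ring \<open>A[x]\<close>. Keeping the polynomial \<open>f\<close> behind
  each element makes it possible to compare degrees of relations later on.\<close>

definition adjoin :: "'a \<Rightarrow> 'a set" where
  "adjoin x = {poly f x | f. range (coeff f) \<subseteq> A}"

lemma unital_subring_adjoin: "unital_subring (adjoin x)"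
proof
  have "range (coeff (1 :: 'a poly)) \<subseteq> A"
    by (auto simp: coeff_1 zero_mem one_mem)
  then show "1 \<in> adjoin x" unfolding adjoin_def by (intro CollectI exI[of _ 1]) auto
next
  fix y z assume "y \<in> adjoin x" "z \<in> adjoin x"
  then obtain f g where f: "range (coeff f) \<subseteq> A" "y = poly f x"
    and g: "range (coeff g) \<subseteq> A" "z = poly g x"
    unfolding adjoin_def by blast
  have "range (coeff (f - g)) \<subseteq> A" using f g by (auto intro: diff_mem)
  then show "y - z \<in> adjoin x"
    unfolding adjoin_def using f g by (intro CollectI exI[of _ "f - g"]) auto
  have "range (coeff (f * g)) \<subseteq> A"
    using f g by (auto simp: coeff_mult intro!: sum_mem mult_mem)
  then show "y * z \<in> adjoin x"
    unfolding adjoin_def using f g by (intro CollectI exI[of _ "f * g"]) auto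
qed

lemma subset_adjoin: "A \<subseteq> adjoin x"
proof
  fix a assume "a \<in> A"
  then have "range (coeff [:a:]) \<subseteq> A" by (auto simp: coeff_pCons zero_mem split: nat.splits)
  then show "a \<in> adjoin x" unfolding adjoin_def by (intro CollectI exI[of _ "[:a:]"]) auto
qed

lemma mem_adjoin: "x \<in> adjoin x"
proof -
  have "range (coeff [:0, 1:]) \<subseteq> A"
    by (auto simp: coeff_pCons zero_mem one_mem split: nat.splits)
  then show ?thesis unfolding adjoin_def by (intro CollectI exI[of _ "[:0, 1:]"]) auto
qed

end

locale valuation_subring = unital_subring +
  assumes mem_or_inverse_mem: "x \<in> A \<or> inverse x \<in> A"
begin

text \<open>The non-units of \<open>A\<close>. Zero is listed separately because
  \<open>inverse 0 = 0\<close> lies in \<open>A\<close>.\<close>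

definition max_ideal :: "'a set" where
  "max_ideal = {x \<in> A. x = 0 \<or> inverse x \<notin> A}"

lemma zero_mem_max_ideal: "0 \<in> max_ideal"
  by (simp add: max_ideal_def zero_mem)

lemma one_notin_max_ideal: "1 \<notin> max_ideal"
  by (simp add: max_ideal_def one_mem)

lemma mult_mem_max_ideal:
  assumes "a \<in> A" "x \<in> max_ideal"
  shows "a * x \<in> max_ideal"
proof -
  have "inverse x \<in> A" if "a * x \<noteq> 0" "inverse (a * x) \<in> A"
    using mult_mem[OF assms(1) that(2)] that(1) by (simp add: field_simps)
  then show ?thesis using assms by (auto simp: max_ideal_def mult_mem)
qed

text \<open>For nonzero \<open>x\<close> and \<open>y\<close>, one of \<open>x / y\<close> and
  \<open>y / x\<close> lies in \<open>A\<close>, so the sum is an \<open>A\<close>-multiple of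
  \<open>x\<close> or of \<open>y\<close>.\<close>

lemma add_mem_max_ideal:
  assumes "x \<in> max_ideal" "y \<in> max_ideal"
  shows "x + y \<in> max_ideal"
proof -
  have *: "u + v \<in> max_ideal" if "u \<in> max_ideal" "v \<in> max_ideal" "u / v \<in> A" "v \<noteq> 0" for u v
  proof -
    have "(u / v + 1) * v \<in> max_ideal"
      using that by (intro mult_mem_max_ideal add_mem one_mem)
    also have "(u / v + 1) * v = u + v" using that by (simp add: field_simps)
    finally show ?thesis .
  qed
  show ?thesis
  proof (cases "x = 0 \<or> y = 0")
    case True
    then show ?thesis using assms by auto
  next
    case False
    then show ?thesis
      using mem_or_inverse_mem[of "x / y"] *[of x y] *[of y x] assms by (auto simp: add.commute)
  qed
qed

lemma uminus_mem_max_ideal: "x \<in> max_ideal \<Longrightarrow> - x \<in> max_ideal"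
  using mult_mem_max_ideal[of "- 1" x] by (simp add: uminus_mem one_mem)

lemma sum_mem_max_ideal: "(\<And>i. i \<in> I \<Longrightarrow> f i \<in> max_ideal) \<Longrightarrow> sum f I \<in> max_ideal"
  by (induction I rule: infinite_finite_induct) (auto intro: zero_mem_max_ideal add_mem_max_ideal)

text \<open>The element \<open>b\<close> has least valuation in \<open>S\<close>. Dividing by it is
  the rescaling that moves all roots into \<open>A\<close> and one of them to 1.\<close>

lemma exists_dominating:
  assumes "finite S" "S \<noteq> {}" "0 \<notin> S"
  shows "\<exists>b\<in>S. \<forall>x\<in>S. x / b \<in> A"
  using assms
proof (induction S rule: finite_ne_induct)
  case (singleton x)
  then show ?case by (simp add: one_mem)
next
  case (insert y S)
  then obtain b where b: "b \<in> S" "\<And>x. x \<in> S \<Longrightarrow> x / b \<in> A" by auto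
  have nz: "b \<noteq> 0" "y \<noteq> 0" using b(1) insert.prems by auto
  show ?case
  proof (cases "y / b \<in> A")
    case True
    then show ?thesis using b by auto
  next
    case False
    then have "b / y \<in> A" using mem_or_inverse_mem[of "y / b"] by simp
    then have "x / y \<in> A" if "x \<in> S" for x
      using mult_mem[OF b(2)[OF that]] nz by fastforce
    then show ?thesis using nz one_mem by auto
  qed
qed

end

text \<open>
  A subring \<open>A\<close> maximal among those not containing \<open>1/c\<close> is a valuation ring: all elements of
  \<open>1 + c A\<close> are units, so relations expressing \<open>1/c\<close> as polynomials in \<open>x\<close> and in \<open>1/x\<close>
  can be played off against each other to lower the larger of their degrees.
\<close>

locale maximal_omitting_subring = unital_subring +
  fixes c :: 'a
  assumes c_mem: "c \<in> A"
    and c_nonzero: "c \<noteq> 0"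
    and inverse_c_notin: "inverse c \<notin> A"
    and maximal: "unital_subring B \<Longrightarrow> A \<subseteq> B \<Longrightarrow> inverse c \<notin> B \<Longrightarrow> B = A"
begin

lemma inverse_c_mem_adjoin:
  assumes "x \<notin> A"
  shows "inverse c \<in> adjoin x"
  using maximal[OF unital_subring_adjoin subset_adjoin] mem_adjoin assms by blast

lemma not_mult_eq_1: "s \<in> A \<Longrightarrow> c * s \<noteq> 1"
  using inverse_c_notin inverse_unique by metis

text \<open>With \<open>e = 1 - c * b\<close>, maximality would otherwise give 1/c = f(1/e).
  Multiplied by e^n, where n is the degree of f, the right side lies in \<open>A\<close>, while e^n
  is 1 modulo c A; so 1/c would lie in \<open>A\<close>.\<close>

lemma inverse_one_minus_mem:
  assumes "b \<in> A"
  shows "inverse (1 - c * b) \<in> A"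
proof (rule ccontr)
  define e where "e = 1 - c * b"
  assume "inverse (1 - c * b) \<notin> A"
  then have "inverse c \<in> adjoin (inverse e)" by (intro inverse_c_mem_adjoin) (simp add: e_def)
  then obtain f where f: "range (coeff f) \<subseteq> A" "inverse c = poly f (inverse e)"
    unfolding adjoin_def by blast
  have e: "e \<in> A" unfolding e_def using assms by (intro diff_mem mult_mem one_mem c_mem)
  have e_nz: "e \<noteq> 0" using not_mult_eq_1[OF assms] by (auto simp: e_def)
  have pow: "\<exists>t\<in>A. e ^ n = 1 - c * t" for n
  proof (induction n)
    case 0
    show ?case by (intro bexI[of _ 0]) (auto simp: zero_mem)
  next
    case (Suc n)
    then obtain t where t: "t \<in> A" "e ^ n = 1 - c * t" by blast
    have "e ^ Suc n = 1 - c * (b + t - c * b * t)"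
      unfolding power_Suc t(2) by (simp add: e_def algebra_simps)
    then show ?case
      using t(1) assms
      by (intro bexI[of _ "b + t - c * b * t"]) (auto intro: add_mem diff_mem mult_mem c_mem)
  qed
  from pow obtain t where t: "t \<in> A" "e ^ degree f = 1 - c * t" by blast
  \<comment> \<open>Reversing the coefficients of \<open>f\<close> clears the denominators: s = e^n
    f(1/e) = e^n / c = 1/c - t.\<close>
  define s where "s = poly (reflect_poly f) e"
  have s: "s \<in> A" unfolding s_def
    using f(1) e by (intro poly_mem) (auto simp: coeff_reflect_poly zero_mem)
  have "s = e ^ degree f * inverse c"
    unfolding s_def using e_nz f(2) by (simp add: poly_reflect_poly_nz)
  then have "c * (s + t) = 1" using t(2) c_nonzero by (simp add: field_simps)
  then show False using not_mult_eq_1 add_mem[OF s t(1)] by blast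
qed

text \<open>The relation in 1/x can be solved for x^m, where m is the degree of \<open>g\<close>, as
  a polynomial in x of degree below m over \<open>A\<close>. Since m is at most the degree of
  \<open>f\<close>, this rewrites the leading term of \<open>f\<close>.\<close>

lemma exists_lower_degree:
  assumes "x \<noteq> 0"
    and f: "range (coeff f) \<subseteq> A" "inverse c = poly f x"
    and g: "range (coeff g) \<subseteq> A" "inverse c = poly g (inverse x)"
    and le: "degree g \<le> degree f"
  shows "\<exists>f'. range (coeff f') \<subseteq> A \<and> inverse c = poly f' x \<and> degree f' < degree f"
proof -
  obtain b g' where g': "g = pCons b g'" by (cases g)
  have "b = coeff g 0" "coeff g' n = coeff g (Suc n)" for n by (simp_all add: g')
  then have b: "b \<in> A" and g'_A: "range (coeff g') \<subseteq> A" using g(1) by auto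
  have "g' \<noteq> 0" using inverse_c_notin b g(2) by (auto simp: g')
  define m where "m = degree g"
  have m: "m = Suc (degree g')" using \<open>g' \<noteq> 0\<close> by (simp add: m_def g')
  define u where "u = inverse (1 - c * b)"
  have u: "u \<in> A" using inverse_one_minus_mem[OF b] by (simp add: u_def)
  have u_nz: "1 - c * b \<noteq> 0" using not_mult_eq_1[OF b] by auto
  \<comment> \<open>Moving the constant term of \<open>g\<close> to the left gives 1 - c b = c
    g'(1/x) / x. Multiplying by the inverse \<open>u\<close> of 1 - c b and by x^m yields x^m =
    h(x).\<close>
  define h where "h = smult (u * c) (reflect_poly g')"
  have h_A: "range (coeff h) \<subseteq> A"
    using g'_A u c_mem
    by (auto simp: h_def coeff_reflect_poly intro!: mult_mem zero_mem intro: range_subsetD)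
  have "degree h \<le> degree g'"
    unfolding h_def by (rule order.trans[OF degree_smult_le degree_reflect_poly_le])
  then have deg_h: "degree h < m" by (simp add: m)
  have "1 - c * b = c * (poly g' (inverse x) * inverse x)"
    using g(2) c_nonzero by (simp add: g' field_simps)
  then have "u * (1 - c * b) = u * c * (poly g' (inverse x) * inverse x)"
    by (simp only: mult.assoc)
  moreover have "u * (1 - c * b) = 1"
    unfolding u_def using u_nz by (rule left_inverse)
  ultimately have "x ^ m = x ^ m * (u * c * (poly g' (inverse x) * inverse x))"
    by (metis mult.right_neutral)
  also have "\<dots> = u * c * (x ^ degree g' * poly g' (inverse x))"
    using assms(1) by (simp add: m)
  finally have h_x: "x ^ m = poly h x"
    using assms(1) by (simp add: h_def poly_reflect_poly_nz)
  define n where "n = degree f"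
  \<comment> \<open>The leading monomial of \<open>f\<close> is l X^m. Replacing X^m by
    \<open>h\<close> there keeps the value at \<open>x\<close> and lowers the degree.\<close>
  define l where "l = monom (lead_coeff f) (n - m)"
  define f' where "f' = f - l * monom 1 m + l * h"
  have "n \<ge> m" "m > 0" using le by (auto simp: n_def m_def[symmetric] m)
  have lm: "l * monom 1 m = monom (lead_coeff f) n"
    using \<open>n \<ge> m\<close> by (simp add: l_def mult_monom)
  have "lead_coeff f \<in> A" using f(1) by auto
  then have "range (coeff l) \<subseteq> A" by (auto simp: l_def zero_mem)
  then have "range (coeff f') \<subseteq> A" unfolding f'_def lm
    using f(1) h_A \<open>lead_coeff f \<in> A\<close>
    by (auto simp: coeff_mult intro!: add_mem diff_mem sum_mem mult_mem zero_mem)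
  moreover have "poly f' x = inverse c"
    using f(2) h_x by (simp add: f'_def poly_monom)
  moreover have "degree f' < n"
  proof -
    have "n > 0" using \<open>n \<ge> m\<close> \<open>m > 0\<close> by simp
    have 1: "degree (f - monom (lead_coeff f) n) < n"
      using \<open>n > 0\<close> by (intro degree_lessI) (auto simp: n_def coeff_eq_0)
    have "degree (l * h) \<le> (n - m) + degree h"
      unfolding l_def by (rule order.trans[OF degree_mult_le]) (simp add: degree_monom_le)
    then have "degree (l * h) < n" using deg_h \<open>n \<ge> m\<close> by simp
    then show ?thesis unfolding f'_def lm using 1 by (intro degree_add_less)
  qed
  ultimately show ?thesis unfolding n_def by metis
qed

lemma mem_or_inverse_mem_if_maximal: "x \<in> A \<or> inverse x \<in> A"
proof (rule ccontr)
  assume "\<not> ?thesis"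
  then have nin: "x \<notin> A" "inverse x \<notin> A" by auto
  then have "x \<noteq> 0" using zero_mem by auto
  define R where "R y f \<longleftrightarrow> range (coeff f) \<subseteq> A \<and> inverse c = poly f y" for y f
  have ex: "\<exists>f. R y f" if "y \<notin> A" for y
    using inverse_c_mem_adjoin[OF that] by (auto simp: R_def adjoin_def)
  \<comment> \<open>Both relations are taken of least degree, so lowering either one is a
    contradiction.\<close>
  obtain f where f: "R x f" "\<And>f'. R x f' \<Longrightarrow> degree f \<le> degree f'"
    by (metis ex nin(1) arg_min_nat_lemma)
  obtain g where g: "R (inverse x) g" "\<And>g'. R (inverse x) g' \<Longrightarrow> degree g \<le> degree g'"
    by (metis ex nin(2) arg_min_nat_lemma)
  show False
  proof (cases "degree g \<le> degree f")
    case True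
    then show False
      using exists_lower_degree[of x f g] f g \<open>x \<noteq> 0\<close> unfolding R_def by (metis leD)
  next
    \<comment> \<open>The roles of \<open>x\<close> and \<open>inverse x\<close> are exchanged
      here.\<close>
    case False
    then show False
      using exists_lower_degree[of "inverse x" g f] f g \<open>x \<noteq> 0\<close> unfolding R_def
      by (metis inverse_inverse_eq inverse_zero_imp_zero leD nat_le_linear)
  qed
qed

end

text \<open>Zorn's lemma applies to the subrings that contain \<open>R\<close> and omit 1/c, since
  both conditions pass to unions of nonempty chains.\<close>

theorem exists_valuation_subring:
  fixes c :: "'a::field"
  assumes "unital_subring R" "c \<in> R" "c \<noteq> 0" "inverse c \<notin> R"
  shows "\<exists>A. valuation_subring A \<and> R \<subseteq> A \<and> inverse c \<notin> A"
proof -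
  define \<A> where "\<A> = {B. unital_subring B \<and> R \<subseteq> B \<and> inverse c \<notin> B}"
  have "\<A> \<noteq> {}" using assms by (auto simp: \<A>_def)
  moreover have "\<Union>\<C> \<in> \<A>" if "\<C> \<noteq> {}" and ch: "subset.chain \<A> \<C>" for \<C>
  proof -
    have C: "unital_subring B" "R \<subseteq> B" "inverse c \<notin> B" if "B \<in> \<C>" for B
      using that ch by (auto simp: \<A>_def subset.chain_def)
    have common: "\<exists>B\<in>\<C>. x \<in> B \<and> y \<in> B" if "x \<in> \<Union>\<C>" "y \<in> \<Union>\<C>" for x y
      using that ch unfolding subset_chain_def by (metis UnionE subsetD)
    have "unital_subring (\<Union>\<C>)"
    proof
      show "1 \<in> \<Union>\<C>" using \<open>\<C> \<noteq> {}\<close> C(1) unital_subring.one_mem by blast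
    next
      fix x y assume "x \<in> \<Union>\<C>" "y \<in> \<Union>\<C>"
      then obtain B where "B \<in> \<C>" "x \<in> B" "y \<in> B" using common by blast
      then show "x - y \<in> \<Union>\<C>" "x * y \<in> \<Union>\<C>"
        using C(1) unital_subring.diff_mem unital_subring.mult_mem by blast+
    qed
    moreover have "R \<subseteq> \<Union>\<C>" using \<open>\<C> \<noteq> {}\<close> C(2) by blast
    ultimately show ?thesis using C(3) by (auto simp: \<A>_def)
  qed
  ultimately obtain A where A: "A \<in> \<A>" "\<And>B. B \<in> \<A> \<Longrightarrow> A \<subseteq> B \<Longrightarrow> B = A"
    using subset_Zorn_nonempty[of \<A>] by blast
  interpret unital_subring A using A(1) by (simp add: \<A>_def)
  \<comment> \<open>Any competing subring above \<open>A\<close> also contains \<open>R\<close>, so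
    maximality within the family suffices.\<close>
  interpret maximal_omitting_subring A c
    using A assms by unfold_locales (auto simp: \<A>_def)
  have "valuation_subring A" using mem_or_inverse_mem_if_maximal by unfold_locales
  then show ?thesis using A(1) by (auto simp: \<A>_def)
qed

text \<open>Start from the ring of integers inside the field, with c = p. Omitting 1/p is what puts
  p into the maximal ideal.\<close>

corollary exists_valuation_subring_residue_char:
  assumes "prime p"
  shows "\<exists>A :: 'a::field_char_0 set. valuation_subring A \<and> inverse (of_nat p) \<notin> A"
proof -
  have "inverse (of_nat p :: 'a) \<notin> \<int>"
  proof
    assume "inverse (of_nat p :: 'a) \<in> \<int>"
    then obtain z where "inverse (of_nat p :: 'a) = of_int z" by (elim Ints_cases)
    then have "of_int (z * int p) = (1 :: 'a)"
      using prime_gt_0_nat[OF assms] by (simp add: field_simps)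
    then have "z * int p = 1" by (metis of_int_eq_1_iff)
    then show False
      using prime_gt_1_nat[OF assms]
      by (metis dvd_triv_right int_dvd_int_iff nat_dvd_1_iff_1 nat_neq_iff of_nat_1)
  qed
  moreover have "unital_subring (\<int> :: 'a set)" by unfold_locales auto
  moreover have "(of_nat p :: 'a) \<noteq> 0" using prime_gt_0_nat[OF assms] by simp
  ultimately show ?thesis using exists_valuation_subring[of \<int> "of_nat p :: 'a"] by auto
qed

section \<open>Binomial coefficients\<close>

text \<open>The identity i C(q,i) = q C(q-1,i-1) with q = p^k forces q to divide i if p does not
  divide C(q,i).\<close>

lemma prime_dvd_prime_power_choose:
  fixes p :: nat
  assumes "prime p" "0 < i" "i < p ^ k"
  shows "p dvd (p ^ k choose i)"
proof (rule ccontr)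
  assume "\<not> ?thesis"
  then have "coprime (p ^ k) (p ^ k choose i)"
    using assms(1) by (simp add: prime_imp_coprime_nat)
  moreover have "p ^ k dvd i * (p ^ k choose i)"
    using times_binomial_minus1_eq[OF assms(2), of "p ^ k"] by simp
  ultimately have "p ^ k dvd i" by (simp add: coprime_dvd_mult_left_iff)
  then show False using assms(2,3) by (simp add: nat_dvd_not_less)
qed

text \<open>Vandermonde's identity for q + q reduces this to products of binomial coefficients of
  q.\<close>

lemma prime_dvd_double_prime_power_choose:
  fixes p :: nat
  assumes "prime p" "0 < i" "i < 2 * p ^ k" "i \<noteq> p ^ k"
  shows "p dvd (2 * p ^ k choose i)"
proof -
  let ?q = "p ^ k"
  have "p dvd (?q choose j) * (?q choose (i - j))" if "j \<le> i" for j
  proof (cases "0 < j \<and> j < ?q \<or> 0 < i - j \<and> i - j < ?q")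
    case True
    then show ?thesis using prime_dvd_prime_power_choose[OF assms(1)] by auto
  next
    case False
    \<comment> \<open>If both indices were 0 or q, then i would be 0, q or 2q, all excluded. So one
      index exceeds q and its binomial coefficient is zero.\<close>
    then have "j > ?q \<or> i - j > ?q" using assms(2-4) that by auto
    then show ?thesis by (auto simp: binomial_eq_0)
  qed
  then have "p dvd (\<Sum>j\<le>i. (?q choose j) * (?q choose (i - j)))" by (intro dvd_sum) auto
  also have "\<dots> = (?q + ?q choose i)" by (rule vandermonde)
  finally show ?thesis by (simp add: mult_2)
qed

section \<open>Hasse derivatives\<close>

lemma poly_hasse_deriv:
  "poly (hasse_deriv i P) x = (\<Sum>j=i..degree P. of_nat (j choose i) * coeff P j * x ^ (j - i))"
  by (simp add: hasse_deriv_def poly_sum poly_monom)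

lemma pcompose_power: "(P ^ n) \<circ>\<^sub>p Q = (P \<circ>\<^sub>p Q) ^ n"
  for P Q :: "'a::comm_semiring_1 poly"
  by (induction n) (simp_all add: pcompose_1 pcompose_mult)

text \<open>This is the iterated chain rule. It shows that common roots with Hasse derivatives
  survive translation and scaling.\<close>

lemma hasse_deriv_pcompose_linear:
  fixes P :: "'a::field_char_0 poly"
  shows "hasse_deriv i (P \<circ>\<^sub>p [:a, b:]) = smult (b ^ i) (hasse_deriv i P \<circ>\<^sub>p [:a, b:])"
proof -
  have "(pderiv ^^ i) (P \<circ>\<^sub>p [:a, b:]) = smult (b ^ i) ((pderiv ^^ i) P \<circ>\<^sub>p [:a, b:])"
    by (induction i) (simp_all add: pderiv_smult pderiv_pcompose pderiv_pCons mult.commute)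
  then show ?thesis by (simp add: hasse_deriv_conv_pderiv pcompose_smult mult.commute)
qed

lemma hasse_deriv_smult: "hasse_deriv i (smult a P) = smult a (hasse_deriv i P)"
  by (rule poly_eqI) (simp add: coeff_hasse_deriv ac_simps)

lemma hasse_deriv_map_poly_to_ac:
  "hasse_deriv i (map_poly to_ac P) = map_poly to_ac (hasse_deriv i P)"
  by (rule poly_eqI) (simp add: coeff_hasse_deriv coeff_map_poly)

section \<open>Polynomials sharing roots with their Hasse derivatives\<close>

lemma (in valuation_subring) casas_alvero_reduction:
  assumes monic: "lead_coeff Q = 1" and "degree Q > 0"
    and roots: "\<And>x. poly Q x = 0 \<Longrightarrow> x \<in> A"
    and zero: "coeff Q 0 = 0"
    and small: "\<And>i. 0 < i \<Longrightarrow> i < degree Q \<Longrightarrow>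
                  of_nat (degree Q choose i) \<in> max_ideal \<or> coeff Q i = 0"
    and common: "\<And>i. 0 < i \<Longrightarrow> i < degree Q \<Longrightarrow> \<exists>x. poly Q x = 0 \<and> poly (hasse_deriv i Q) x = 0"
  shows "poly Q 1 \<noteq> 0"
proof
  let ?d = "degree Q"
  have coeffs: "coeff Q i \<in> max_ideal" if "i < ?d" for i
    using that
  proof (induction "?d - i" arbitrary: i rule: less_induct)
    case less
    consider "coeff Q i = 0" | "0 < i" "of_nat (?d choose i) \<in> max_ideal"
      using small zero less.prems by (cases "i = 0") auto
    then show ?case
    proof cases
      case 1
      then show ?thesis by (simp add: zero_mem_max_ideal)
    next
      case 2
      obtain x where x: "x \<in> A" "poly (hasse_deriv i Q) x = 0"
        using common[OF 2(1) less.prems] roots by blast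
      \<comment> \<open>The top term has coefficient 1, so there the binomial coefficient must lie
        in the ideal. For the terms in between, the induction hypothesis puts
        \<open>coeff Q j\<close> into it.\<close>
      have "of_nat (j choose i) * coeff Q j * x ^ (j - i) \<in> max_ideal" if "j \<in> {Suc i..?d}" for j
      proof (cases "j = ?d")
        case True
        then show ?thesis
          using 2(2) monic mult_mem_max_ideal[OF power_mem[OF x(1)]] by (simp add: mult.commute)
      next
        case False
        then have "coeff Q j \<in> max_ideal" using that by (intro less.hyps) auto
        then show ?thesis
          using mult_mem_max_ideal[OF mult_mem[OF of_nat_mem power_mem[OF x(1)]]]
          by (metis mult.assoc mult.commute)
      qed
      then have "(\<Sum>j=Suc i..?d. of_nat (j choose i) * coeff Q j * x ^ (j - i)) \<in> max_ideal"
        by (rule sum_mem_max_ideal)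
      moreover have "coeff Q i + (\<Sum>j=Suc i..?d. of_nat (j choose i) * coeff Q j * x ^ (j - i)) = 0"
        using x(2) less.prems by (simp add: poly_hasse_deriv sum.atLeast_Suc_atMost)
      ultimately show ?thesis
        using uminus_mem_max_ideal by (metis add_eq_0_iff2)
    qed
  qed
  assume "poly Q 1 = 0"
  \<comment> \<open>A root at 1 makes the leading coefficient minus the sum of the others, all of
    which lie in the ideal.\<close>
  then have "1 = - (\<Sum>i<?d. coeff Q i)"
    using monic by (simp add: poly_altdef lessThan_Suc_atMost[symmetric] add_eq_0_iff2)
  moreover have "(\<Sum>i<?d. coeff Q i) \<in> max_ideal" using coeffs by (intro sum_mem_max_ideal) auto
  ultimately show False using one_notin_max_ideal uminus_mem_max_ideal by metis
qed

lemma monic_eq_linear_power_if_single_root: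
  fixes P :: "'a::alg_closed_field poly"
  assumes "lead_coeff P = 1" and "\<And>x. poly P x = 0 \<Longrightarrow> x = a"
  shows "P = [:- a, 1:] ^ degree P"
proof -
  obtain B where B: "size B = degree P" "P = smult (lead_coeff P) (\<Prod>x\<in>#B. [:- x, 1:])"
    using alg_closed_imp_factorization[of P] assms(1) by fastforce
  have "x = a" if "x \<in># B" for x
  proof -
    have "poly P x = 0"
      using that assms(1) by (subst B(2)) (auto simp: poly_prod_mset prod_mset_zero_iff)
    then show ?thesis by (rule assms(2))
  qed
  then have "(\<Prod>x\<in>#B. [:- x, 1:]) = (\<Prod>x\<in>#B. [:- a, 1:])"
    by (intro arg_cong[of _ _ prod_mset] image_mset_cong) auto
  then show ?thesis using B assms(1) by simp
qed

section \<open>The theorem over an algebraically closed field\<close>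

theorem casas_alvero_alg_closed:
  fixes P :: "'a::{alg_closed_field, field_char_0} poly"
  assumes "prime p" and d: "d = p ^ k \<or> d = 2 * p ^ k"
    and monic: "lead_coeff P = 1" and deg: "degree P = d"
    and common: "\<And>i. 0 < i \<Longrightarrow> i < d \<Longrightarrow> \<exists>x. poly P x = 0 \<and> poly (hasse_deriv i P) x = 0"
  shows "\<exists>a. P = [:- a, 1:] ^ d"
proof -
  have "d > 0" "p ^ k > 0" using d prime_gt_0_nat[OF \<open>prime p\<close>] by auto
  \<comment> \<open>If d = p^k, any root serves. If d = 2 p^k, the middle index p^k is the one whose
    binomial coefficient may be prime to p, so the translation is chosen to kill that
    coefficient.\<close>
  have "\<exists>a. poly P a = 0 \<and> (p ^ k < d \<longrightarrow> poly (hasse_deriv (p ^ k) P) a = 0)"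
  proof (cases "p ^ k < d")
    case True
    then show ?thesis using common[of "p ^ k"] \<open>p ^ k > 0\<close> by auto
  next
    case False
    then show ?thesis using alg_closed_imp_poly_has_root[of P] \<open>d > 0\<close> deg by auto
  qed
  then obtain a where a: "poly P a = 0" "p ^ k < d \<Longrightarrow> poly (hasse_deriv (p ^ k) P) a = 0" by blast
  obtain A :: "'a set" where A: "valuation_subring A" "inverse (of_nat p) \<notin> A"
    using exists_valuation_subring_residue_char[OF \<open>prime p\<close>] by blast
  interpret valuation_subring A by (fact A(1))
  have p_mem: "of_nat p \<in> max_ideal" using A(2) by (simp add: max_ideal_def of_nat_mem)
  have "x = a" if "poly P x = 0" for x
  proof (rule ccontr)
    assume "x \<noteq> a"
    define S where "S = (\<lambda>y. y - a) ` {y. poly P y = 0 \<and> y \<noteq> a}"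
    have "P \<noteq> 0" using deg \<open>d > 0\<close> by auto
    then have "finite S" unfolding S_def using poly_roots_finite[of P] by auto
    moreover have "S \<noteq> {}" "0 \<notin> S" using \<open>x \<noteq> a\<close> that by (auto simp: S_def)
    ultimately obtain b where b: "b \<in> S" "\<And>y. y \<in> S \<Longrightarrow> y / b \<in> A"
      using exists_dominating[of S] by auto
    then have "b \<noteq> 0" and Pab: "poly P (a + b) = 0" by (auto simp: S_def)
    \<comment> \<open>The roots of \<open>Q\<close> are (y - a) / b for the roots y of
      \<open>P\<close>, among them 0 and 1. The scalar factor makes \<open>Q\<close> monic.\<close>
    define Q where "Q = smult (inverse (b ^ d)) (P \<circ>\<^sub>p [:a, b:])"
    have deg_Q: "degree Q = d" using \<open>b \<noteq> 0\<close> deg by (simp add: Q_def degree_pcompose)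
    have Q_root: "poly Q y = 0 \<longleftrightarrow> poly P (a + b * y) = 0" for y
      using \<open>b \<noteq> 0\<close> by (simp add: Q_def poly_pcompose mult.commute)
    have Q_hasse: "poly (hasse_deriv i Q) y = 0 \<longleftrightarrow> poly (hasse_deriv i P) (a + b * y) = 0" for i y
      using \<open>b \<noteq> 0\<close>
      by (simp add: Q_def hasse_deriv_smult hasse_deriv_pcompose_linear poly_pcompose mult.commute)
    have hasse_0: "poly (hasse_deriv i Q) 0 = coeff Q i" for i
      by (simp add: poly_0_coeff_0 coeff_hasse_deriv)
    have "poly Q 1 \<noteq> 0"
    proof (rule casas_alvero_reduction)
      show "lead_coeff Q = 1"
        using \<open>b \<noteq> 0\<close> monic deg by (simp add: Q_def lead_coeff_comp)
      show "degree Q > 0" using deg_Q \<open>d > 0\<close> by simp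
      show "coeff Q 0 = 0" using Q_root[of 0] a(1) by (simp add: poly_0_coeff_0)
      show "y \<in> A" if "poly Q y = 0" for y
      proof (cases "y = 0")
        case True
        then show ?thesis by (simp add: zero_mem)
      next
        case False
        then have "a + b * y - a \<in> S"
          unfolding S_def using that Q_root \<open>b \<noteq> 0\<close> by (intro imageI) auto
        then show ?thesis using b(2) \<open>b \<noteq> 0\<close> by fastforce
      qed
      fix i assume i: "0 < i" "i < degree Q"
      obtain y where y: "poly P y = 0" "poly (hasse_deriv i P) y = 0"
        using common i deg_Q by blast
      have "a + b * ((y - a) / b) = y" using \<open>b \<noteq> 0\<close> by simp
      then show "\<exists>z. poly Q z = 0 \<and> poly (hasse_deriv i Q) z = 0"
        using y Q_root Q_hasse by metis
      show "of_nat (degree Q choose i) \<in> max_ideal \<or> coeff Q i = 0"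
      proof (cases "i = p ^ k")
        case True
        \<comment> \<open>The coefficient of \<open>Q\<close> at i is its Hasse derivative at 0, and
          0 corresponds to the root \<open>a\<close> of \<open>P\<close>.\<close>
        then show ?thesis using a(2) i deg_Q Q_hasse[of i 0] hasse_0 by simp
      next
        case False
        then have "p dvd (d choose i)"
          using d i deg_Q prime_dvd_prime_power_choose prime_dvd_double_prime_power_choose \<open>prime p\<close>
          by metis
        then obtain n where "d choose i = p * n" by (elim dvdE)
        then show ?thesis
          using mult_mem_max_ideal[OF of_nat_mem[of n] p_mem] deg_Q by (simp add: mult.commute)
      qed
    qed
    then show False using Q_root[of 1] Pab by simp
  qed
  then show ?thesis using monic_eq_linear_power_if_single_root[OF monic] deg by metis
qed

section \<open>Passage between the field and its algebraic closure\<close>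

lemma map_poly_to_ac_mult: "map_poly to_ac (f * g) = map_poly to_ac f * map_poly to_ac g"
  by (rule poly_eqI) (simp add: coeff_map_poly coeff_mult to_ac_sum)

lemma map_poly_to_ac_power: "map_poly to_ac (f ^ n) = map_poly to_ac f ^ n"
  by (induction n) (simp_all add: map_poly_to_ac_mult)

lemma map_poly_to_ac_eq_iff: "map_poly to_ac f = map_poly to_ac g \<longleftrightarrow> f = g"
  by (auto simp: poly_eq_iff coeff_map_poly)

lemma coeff_linear_power_pred:
  "coeff ([:- a, 1:] ^ Suc n) n = - of_nat (Suc n) * (a :: 'a::field_char_0)"
  by (subst coeff_linear_poly_power) (auto simp: algebra_simps)

lemma common_root_if_degree_poly_gcd_pos:
  fixes f g :: "'a::field poly"
  assumes "degree (poly_gcd f g) > 0"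
  shows "\<exists>x. poly (map_poly to_ac f) x = 0 \<and> poly (map_poly to_ac g) x = 0"
proof -
  let ?h = "poly_gcd f g"
  have "degree (map_poly to_ac ?h) > 0" using assms by (simp add: degree_map_poly)
  then obtain x where "poly (map_poly to_ac ?h) x = 0"
    using alg_closed_imp_poly_has_root by blast
  moreover have "?h dvd f" "?h dvd g"
    using is_poly_gcd_poly_gcd[of f g] by (auto simp: is_poly_gcd_def)
  ultimately show ?thesis by (metis dvdE map_poly_to_ac_mult mult_zero_left poly_mult)
qed

text \<open>The factor X - a divides the gcd, and f being nonzero keeps the gcd nonzero, so degrees
  can be compared.\<close>

lemma degree_poly_gcd_pos_if_common_root:
  fixes f g :: "'a::field poly"
  assumes "f \<noteq> 0" "poly f a = 0" "poly g a = 0"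
  shows "degree (poly_gcd f g) > 0"
proof -
  have gcd: "is_poly_gcd f g (poly_gcd f g)" by (rule is_poly_gcd_poly_gcd)
  then have "[:- a, 1:] dvd poly_gcd f g" "poly_gcd f g \<noteq> 0"
    using assms by (auto simp: is_poly_gcd_def poly_eq_0_iff_dvd)
  then show ?thesis using dvd_imp_degree_le[of "[:- a, 1:]" "poly_gcd f g"] by simp
qed

theorem mainTheorem1:
  fixes p k d :: nat and P :: "'a::field_char_0 poly"
  assumes "prime p"
    and "d = p ^ k \<or> d = 2 * p ^ k"
    and "lead_coeff P = 1"
    and "degree P = d"
  shows "(\<forall>i\<in>{1..d - 1}. degree (poly_gcd P (hasse_deriv i P)) > 0) \<longleftrightarrow>
         (\<exists>\<alpha>. P = [:- \<alpha>, 1:] ^ d)"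
proof
  assume *: "\<forall>i\<in>{1..d - 1}. degree (poly_gcd P (hasse_deriv i P)) > 0"
  let ?P = "map_poly to_ac P"
  have "d > 0" using assms(1,2) prime_gt_0_nat by auto
  have "\<exists>a. ?P = [:- a, 1:] ^ d"
  proof (rule casas_alvero_alg_closed[OF assms(1,2)])
    show "lead_coeff ?P = 1" "degree ?P = d"
      using assms(3,4) by (simp_all add: degree_map_poly coeff_map_poly)
    fix i assume "0 < i" "i < d"
    then show "\<exists>x. poly ?P x = 0 \<and> poly (hasse_deriv i ?P) x = 0"
      unfolding hasse_deriv_map_poly_to_ac
      by (intro common_root_if_degree_poly_gcd_pos) (use * in auto)
  qed
  then obtain a where a: "?P = [:- a, 1:] ^ d" by blast
  obtain n where n: "d = Suc n" using \<open>d > 0\<close> by (cases d) auto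
  \<comment> \<open>The coefficient of X^(d-1) in (X - a)^d is -d a. As d is invertible in
    characteristic 0, \<open>a\<close> already comes from the base field.\<close>
  define \<alpha> where "\<alpha> = - coeff P n / of_nat d"
  have "to_ac (coeff P n) = - of_nat d * a"
    using arg_cong[OF a, of "\<lambda>f. coeff f n"] unfolding n coeff_linear_power_pred
    by (simp add: coeff_map_poly)
  then have "to_ac \<alpha> = a" using \<open>d > 0\<close> by (simp add: \<alpha>_def)
  then have "?P = map_poly to_ac ([:- \<alpha>, 1:] ^ d)"
    unfolding a map_poly_to_ac_power by (simp add: map_poly_pCons)
  then show "\<exists>\<alpha>. P = [:- \<alpha>, 1:] ^ d" by (auto simp: map_poly_to_ac_eq_iff)
next
  assume "\<exists>\<alpha>. P = [:- \<alpha>, 1:] ^ d"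
  then obtain \<alpha> where P: "P = [:- \<alpha>, 1:] ^ d" ..
  show "\<forall>i\<in>{1..d - 1}. degree (poly_gcd P (hasse_deriv i P)) > 0"
  proof
    fix i assume i: "i \<in> {1..d - 1}"
    \<comment> \<open>Translating \<alpha> to 0 turns \<open>P\<close> into X^d, and the i-th
      coefficient of the translate is the value of the i-th Hasse derivative at \<alpha>.\<close>
    have "P \<circ>\<^sub>p [:\<alpha>, 1:] = monom 1 d"
      unfolding P by (simp add: pcompose_power pcompose_pCons monom_altdef)
    then have "coeff (P \<circ>\<^sub>p [:\<alpha>, 1:]) i = 0" using i by auto
    moreover have "coeff (P \<circ>\<^sub>p [:\<alpha>, 1:]) i = poly (hasse_deriv i P) \<alpha>"
      using coeff_hasse_deriv[of i "P \<circ>\<^sub>p [:\<alpha>, 1:]" 0]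
      by (simp add: hasse_deriv_pcompose_linear)
    moreover have "P \<noteq> 0" "poly P \<alpha> = 0" using assms(3) i by (auto simp: P)
    ultimately show "degree (poly_gcd P (hasse_deriv i P)) > 0"
      by (intro degree_poly_gcd_pos_if_common_root) auto
  qed
qed

end
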